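(* Let $k>0$, suppose $A:L^1(\mathbb{R})\to L^\infty(\mathbb{R})$ is a $k$-Hadamard operator, and suppose $f$ is doubly $L^1$ for $A$. Then for any $1\le q\le\infty$, \[ \|f\|_1\,\|Af\|_1\ \ge\ k^{1-1/q}\,\|f\|_q\,\|Af\|_q . \]
   Context: All functions are complex-valued and norms are with respect to Lebesgue measure on $\mathbb{R}$; $1/\infty=0$. Given a linear operator $A:L^1(\mathbb{R})\to L^\infty(\mathbb{R})$, a function $f$ is called doubly $L^1$ for $A$ if $f\in L^1(\mathbb{R})$ and $Af\in L^1(\mathbb{R})$. The operator $A$ is called $k$-Hadamard if $\|A\|_{1\to\infty}\le 1$ (i.e. $\|Af\|_\infty\le\|f\|_1$ for all $f\in L^1(\mathbb{R})$) and $\|A^*Af\|_\infty\ge k\|f\|_\infty$ for all $f$ that are doubly $L^1$ for $A$. Here $A^*:L^1(\mathbb{R})\to L^\infty(\mathbb{R})$ is the adjoint, determined by $\int (Af)\,\overline{g}\,dx=\int f\,\overline{A^*g}\,dx$ for all $f,g\in L^1(\mathbb{R})$. *)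

theory Defs
  imports "HOL-Probability.Essential_Supremum"
begin

text \<open>
  Elements of \<open>L\<^sup>p(\<real>)\<close> are represented by functions \<open>real \<Rightarrow> complex\<close>; equality of elements is
  equality almost everywhere.
\<close>

text \<open>Powers on \<open>[0,\<infinity>]\<close> with exponent \<open>p > 0\<close>, so that \<open>\<infinity>\<close> is sent to \<open>\<infinity>\<close>.\<close>

definition ennpow :: "ennreal \<Rightarrow> real \<Rightarrow> ennreal" where
  "ennpow x p = (if x = \<infinity> then \<infinity> else ennreal (enn2real x powr p))"

definition Lnorm :: "ennreal \<Rightarrow> (real \<Rightarrow> complex) \<Rightarrow> ennreal" where
  "Lnorm q f =
    (if q = \<infinity> then esssup lebesgue (\<lambda>x. ennreal (cmod (f x)))
     else ennpow (\<integral>\<^sup>+x. ennreal (cmod (f x) powr enn2real q) \<partial>lebesgue) (1 / enn2real q))"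

definition L1 :: "(real \<Rightarrow> complex) set" where
  "L1 = {f. integrable lebesgue f}"

definition Linf :: "(real \<Rightarrow> complex) set" where
  "Linf = {f \<in> borel_measurable lebesgue. Lnorm \<infinity> f < \<infinity>}"

text \<open>
  A linear operator \<open>L\<^sup>1(\<real>) \<rightarrow> L\<^sup>\<infinity>(\<real>)\<close>, acting on representatives; the second conjunct says that it is
  well defined on classes of functions. Values outside \<open>L1\<close> are irrelevant.
\<close>

definition linear_L1_Linf :: "((real \<Rightarrow> complex) \<Rightarrow> (real \<Rightarrow> complex)) \<Rightarrow> bool" where
  "linear_L1_Linf A \<longleftrightarrow>
    (\<forall>f\<in>L1. A f \<in> Linf) \<and>
    (\<forall>f\<in>L1. \<forall>g\<in>L1. (AE x in lebesgue. f x = g x) \<longrightarrow> (AE x in lebesgue. A f x = A g x)) \<and>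
    (\<forall>f\<in>L1. \<forall>g\<in>L1. AE x in lebesgue. A (\<lambda>t. f t + g t) x = A f x + A g x) \<and>
    (\<forall>c. \<forall>f\<in>L1. AE x in lebesgue. A (\<lambda>t. c * f t) x = c * A f x)"

definition doubly_L1 ::
    "((real \<Rightarrow> complex) \<Rightarrow> (real \<Rightarrow> complex)) \<Rightarrow> (real \<Rightarrow> complex) \<Rightarrow> bool" where
  "doubly_L1 A f \<longleftrightarrow> f \<in> L1 \<and> A f \<in> L1"

definition is_adjoint ::
    "((real \<Rightarrow> complex) \<Rightarrow> (real \<Rightarrow> complex)) \<Rightarrow> ((real \<Rightarrow> complex) \<Rightarrow> (real \<Rightarrow> complex)) \<Rightarrow> bool" where
  "is_adjoint A B \<longleftrightarrow>
    (\<forall>g\<in>L1. B g \<in> Linf) \<and>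
    (\<forall>f\<in>L1. \<forall>g\<in>L1.
      (LINT x|lebesgue. A f x * cnj (g x)) = (LINT x|lebesgue. f x * cnj (B g x)))"

text \<open>
  For a bounded operator the adjoint exists (\<open>L\<^sup>\<infinity>\<close> is the dual of \<open>L\<^sup>1\<close>), and \<open>is_adjoint\<close> determines
  it on \<open>L1\<close> up to equality almost everywhere, so the choice of representatives is immaterial.
\<close>

definition adjoint_op ::
    "((real \<Rightarrow> complex) \<Rightarrow> (real \<Rightarrow> complex)) \<Rightarrow> ((real \<Rightarrow> complex) \<Rightarrow> (real \<Rightarrow> complex))" where
  "adjoint_op A = (SOME B. is_adjoint A B)"

definition hadamard_op :: "real \<Rightarrow> ((real \<Rightarrow> complex) \<Rightarrow> (real \<Rightarrow> complex)) \<Rightarrow> bool" where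
  "hadamard_op k A \<longleftrightarrow>
    linear_L1_Linf A \<and>
    (\<forall>f\<in>L1. Lnorm \<infinity> (A f) \<le> Lnorm 1 f) \<and>
    (\<forall>f. doubly_L1 A f \<longrightarrow> Lnorm \<infinity> (adjoint_op A (A f)) \<ge> ennreal k * Lnorm \<infinity> f)"

end

theory Submission
  imports Defs
begin

text \<open>
  Write \<open>a = \<parallel>f\<parallel>\<^sub>1\<close> and \<open>b = \<parallel>A f\<parallel>\<^sub>1\<close>. Two sup-norm bounds carry the proof. Since \<open>A\<close> is a contraction
  from \<open>L\<^sup>1\<close> to \<open>L\<^sup>\<infinity>\<close>, \<open>\<parallel>A f\<parallel>\<^sub>\<infinity> \<le> a\<close>. Its adjoint is a contraction as well, and \<open>A f\<close> is again in
  \<open>L\<^sup>1\<close>, so \<open>k \<parallel>f\<parallel>\<^sub>\<infinity> \<le> \<parallel>A\<^sup>* A f\<parallel>\<^sub>\<infinity> \<le> b\<close>. Each function is now controlled in \<open>L\<^sup>1\<close> and in \<open>L\<^sup>\<infinity>\<close>, and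
  with \<open>t = 1/q\<close> interpolation (\<open>Lnorm_interpolation\<close>) gives \<open>\<parallel>f\<parallel>\<^sub>q \<le> (b/k)\<^sup>1\<^sup>-\<^sup>t a\<^sup>t\<close> and
  \<open>\<parallel>A f\<parallel>\<^sub>q \<le> a\<^sup>1\<^sup>-\<^sup>t b\<^sup>t\<close>. The product of the two right-hand sides is \<open>k\<^sup>t\<^sup>-\<^sup>1 a b\<close>, which is the claim.

  The substantial point is the adjoint. That it exists (\<open>adjoint_op_is_adjoint\<close>) is the duality
  between \<open>L\<^sup>1\<close> and \<open>L\<^sup>\<infinity>\<close>: every bounded functional on \<open>L\<^sup>1\<close> of a sigma-finite measure is
  integration against a bounded function (\<open>L1_dual_representation\<close>). After a
  reduction to finite measure, that function is the Radon-Nikodym density of the values of the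
  functional on indicators. That the adjoint contracts
  (\<open>adjoint_contraction\<close>) follows because a function whose averages over sets of finite measure are
  all bounded by \<open>C\<close> is itself bounded by \<open>C\<close> almost everywhere
  (\<open>AE_norm_le_if_set_integrals_le\<close>).
\<close>

section \<open>Boundedness from set averages, and densities of set functions\<close>

text \<open>
  Adding \<open>C\<close> times the measure turns the set function \<open>m\<close> into a nonnegative one dominated by
  \<open>2 C\<close> times the measure. The domination gives both countable additivity (continuity at the empty
  set) and absolute continuity, so the theorem of Radon and Nikodym applies without a decomposition
  of \<open>m\<close> into positive and negative parts.
\<close>

lemma (in finite_measure) bounded_additive_set_function_has_density:
  fixes m :: "'a set \<Rightarrow> real"
  assumes additive: "\<And>E F. E \<in> sets M \<Longrightarrow> F \<in> sets M \<Longrightarrow> E \<inter> F = {} \<Longrightarrow> m (E \<union> F) = m E + m F"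
    and bound: "\<And>E. E \<in> sets M \<Longrightarrow> \<bar>m E\<bar> \<le> C * measure M E"
  obtains h :: "'a \<Rightarrow> real"
  where "integrable M h" and "\<And>E. E \<in> sets M \<Longrightarrow> (LINT x:E|M. h x) = m E"
proof -
  define \<nu> where "\<nu> E = m E + C * measure M E" for E
  define N where "N = measure_of (space M) (sets M) (\<lambda>E. ennreal (\<nu> E))"
  have \<nu>_nonneg: "0 \<le> \<nu> E" if "E \<in> sets M" for E
    using bound[OF that] by (simp add: \<nu>_def)
  have \<nu>_le: "\<nu> E \<le> 2 * C * measure M E" if "E \<in> sets M" for E
    using bound[OF that] by (simp add: \<nu>_def)
  have empty: "\<nu> {} = 0"
    using bound[of "{}"] by (simp add: \<nu>_def)
  have add\<nu>: "\<nu> (E \<union> F) = \<nu> E + \<nu> F" if "E \<in> sets M" "F \<in> sets M" "E \<inter> F = {}" for E F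
    using that by (simp add: \<nu>_def additive finite_measure_Union algebra_simps)
  have pos: "positive (sets M) (\<lambda>E. ennreal (\<nu> E))"
    by (simp add: positive_def empty)
  have "countably_additive (sets M) (\<lambda>E. ennreal (\<nu> E))"
  proof (rule sets.empty_continuous_imp_countably_additive[OF pos])
    show "Measure_Space.additive (sets M) (\<lambda>E. ennreal (\<nu> E))"
      unfolding Measure_Space.additive_def by (auto simp: add\<nu> \<nu>_nonneg ennreal_plus)
    show "\<forall>A\<in>sets M. ennreal (\<nu> A) \<noteq> \<infinity>" by simp
  next
    fix A :: "nat \<Rightarrow> 'a set"
    assume A: "range A \<subseteq> sets M" "decseq A" "(\<Inter>i. A i) = {}"
    have "(\<lambda>i. measure M (A i)) \<longlonglongrightarrow> 0"
      using finite_Lim_measure_decseq[OF A(1,2)] A(3) by simp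
    then have lim: "(\<lambda>i. 2 * C * measure M (A i)) \<longlonglongrightarrow> 0"
      by (rule tendsto_mult_right_zero)
    have "(\<lambda>i. \<nu> (A i)) \<longlonglongrightarrow> 0"
      by (rule tendsto_sandwich[OF _ _ tendsto_const lim])
        (use A(1) in \<open>auto intro!: always_eventually \<nu>_nonneg \<nu>_le\<close>)
    then show "(\<lambda>i. ennreal (\<nu> (A i))) \<longlonglongrightarrow> 0"
      using tendsto_ennrealI by fastforce
  qed
  then have emeasure_N: "emeasure N E = ennreal (\<nu> E)" if "E \<in> sets M" for E
    unfolding N_def by (intro emeasure_measure_of_sigma pos that sets.sigma_algebra_axioms)
  have sets_N: "sets N = sets M" and space_N: "space N = space M"
    by (simp_all add: N_def)
  have fin: "finite_measure N"
    by (rule finite_measureI) (simp add: space_N emeasure_N)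
  have ac: "absolutely_continuous M N"
    unfolding absolutely_continuous_def
  proof
    fix E assume "E \<in> null_sets M"
    then show "E \<in> null_sets N"
      using \<nu>_le[of E] by (auto simp: null_sets_def sets_N emeasure_N ennreal_eq_0_iff measure_def)
  qed
  obtain D where D: "D \<in> borel_measurable M" "AE x in M. RN_deriv M N x = ennreal (D x)" "\<And>x. 0 \<le> D x"
    using real_RN_deriv[OF fin ac sets_N] by blast
  have N_eq: "density M (\<lambda>x. ennreal (D x)) = N"
    using density_cong[of "RN_deriv M N" M "\<lambda>x. ennreal (D x)"] D density_RN_deriv[OF ac sets_N]
    by simp
  have "integrable (density M (\<lambda>x. ennreal (D x))) (\<lambda>x. 1::real)"
    unfolding N_eq by (rule finite_measure.integrable_const[OF fin])
  then have int_D: "integrable M D"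
    by (subst (asm) integrable_density) (use D in auto)
  show ?thesis
  proof
    show "integrable M (\<lambda>x. D x - C)" using int_D by simp
    fix E assume E: "E \<in> sets M"
    have "measure N E = integral\<^sup>L (density M (\<lambda>x. ennreal (D x))) (indicat_real E)"
      unfolding N_eq using E sets.sets_into_space[OF E] by (simp add: space_N Int_absorb2)
    also have "\<dots> = (LINT x|M. D x *\<^sub>R indicat_real E x)"
      by (rule integral_density) (use D E in auto)
    also have "\<dots> = (LINT x:E|M. D x)"
      by (simp add: set_lebesgue_integral_def mult.commute)
    finally have "(LINT x:E|M. D x) = measure N E" ..
    also have "\<dots> = \<nu> E" using E by (simp add: measure_def emeasure_N \<nu>_nonneg)
    finally have "(LINT x:E|M. D x) = \<nu> E" .
    moreover have "set_integrable M E D" "set_integrable M E (\<lambda>x. C)"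
      using E int_D by (simp_all only: set_integrable_def integrable_mult_indicator integrable_const)
    then have "(LINT x:E|M. D x - C) = (LINT x:E|M. D x) - C * measure M E"
      using E by (subst set_integral_diff) (simp_all add: set_lebesgue_integral_def sets.Int_space_eq2 mult.commute)
    ultimately show "(LINT x:E|M. D x - C) = m E" by (simp add: \<nu>_def)
  qed
qed

text \<open>
  The averaging theorem needs an integrable function, so it is applied to the restrictions of \<open>h\<close>
  to the members of an exhaustion by sets of finite measure.
\<close>

lemma (in sigma_finite_measure) AE_norm_le_if_set_integrals_le:
  fixes h :: "'a \<Rightarrow> 'b::{second_countable_topology, banach}"
  assumes "0 \<le> C"
    and int: "\<And>E. E \<in> sets M \<Longrightarrow> emeasure M E < \<infinity> \<Longrightarrow> set_integrable M E h"
    and bound: "\<And>E. E \<in> sets M \<Longrightarrow> emeasure M E < \<infinity> \<Longrightarrow> norm (LINT x:E|M. h x) \<le> C * measure M E"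
  shows "AE x in M. norm (h x) \<le> C"
proof -
  obtain A :: "nat \<Rightarrow> 'a set" where A: "range A \<subseteq> sets M" "(\<Union>i. A i) = space M" "\<And>i. emeasure M (A i) \<noteq> \<infinity>"
    using sigma_finite by blast
  then have A_sets: "A i \<in> sets M" for i by auto
  have "AE x in M. x \<in> A i \<longrightarrow> norm (h x) \<le> C" for i
  proof -
    have "AE x in M. indicator (A i) x *\<^sub>R h x \<in> cball 0 C"
    proof (rule averaging_theorem)
      show "integrable M (\<lambda>x. indicator (A i) x *\<^sub>R h x)"
        using int[OF A_sets] A(3) by (simp add: set_integrable_def less_top[symmetric])
    next
      fix E assume E: "E \<in> sets M" "0 < measure M E"
      have E_fin: "emeasure M E < \<infinity>"
        using E(2) by (metis ennreal_0 infinity_ennreal_def less_irrefl less_top measure_zero_top)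
      have "emeasure M (E \<inter> A i) \<le> emeasure M E"
        using E by (intro emeasure_mono) auto
      then have fin: "emeasure M (E \<inter> A i) < \<infinity>" using E_fin by (rule le_less_trans)
      have "(LINT x:E|M. indicator (A i) x *\<^sub>R h x) = (LINT x:E \<inter> A i|M. h x)"
        by (simp add: set_lebesgue_integral_def indicator_inter_arith)
      then have "norm (LINT x:E|M. indicator (A i) x *\<^sub>R h x) \<le> C * measure M (E \<inter> A i)"
        using bound[of "E \<inter> A i"] E A_sets fin by auto
      also have "\<dots> \<le> C * measure M E"
        using \<open>0 \<le> C\<close> E E_fin by (intro mult_left_mono measure_mono_fmeasurable)
          (auto simp: fmeasurable_def A_sets)
      finally show "(1 / measure M E) *\<^sub>R (LINT x:E|M. indicator (A i) x *\<^sub>R h x) \<in> cball 0 C"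
        using E(2) by (simp add: field_simps)
    qed simp
    then show ?thesis by (auto elim: eventually_mono)
  qed
  then have "AE x in M. \<forall>i. x \<in> A i \<longrightarrow> norm (h x) \<le> C"
    unfolding AE_all_countable by blast
  then show ?thesis
  proof (rule AE_mp, intro AE_I2 impI)
    fix x assume "x \<in> space M" "\<forall>i. x \<in> A i \<longrightarrow> norm (h x) \<le> C"
    then show "norm (h x) \<le> C" using A(2) by blast
  qed
qed

section \<open>The dual of \<open>L\<^sup>1\<close>\<close>

text \<open>
  On a finite measure space the indicators are integrable, so the real and imaginary parts of
  \<open>E \<mapsto> \<Phi> (indicator E)\<close> have densities, which together form \<open>h\<close>. The averages of \<open>h\<close> are bounded
  by \<open>C\<close>, hence so is \<open>h\<close>; then both sides of the representation are continuous in the \<open>L\<^sup>1\<close> norm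
  and agree on indicators.
\<close>

lemma (in finite_measure) finite_L1_dual_representation:
  fixes \<Phi> :: "('a \<Rightarrow> complex) \<Rightarrow> complex"
  assumes "0 \<le> C"
    and add: "\<And>f g. integrable M f \<Longrightarrow> integrable M g \<Longrightarrow> \<Phi> (\<lambda>x. f x + g x) = \<Phi> f + \<Phi> g"
    and scale: "\<And>c f. integrable M f \<Longrightarrow> \<Phi> (\<lambda>x. c * f x) = c * \<Phi> f"
    and bound: "\<And>f. integrable M f \<Longrightarrow> cmod (\<Phi> f) \<le> C * (LINT x|M. cmod (f x))"
  obtains h where "h \<in> borel_measurable M" and "AE x in M. cmod (h x) \<le> C"
    and "\<And>f. integrable M f \<Longrightarrow> \<Phi> f = (LINT x|M. f x * h x)"
proof -
  define m where "m E = \<Phi> (indicator E)" for E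
  have int_ind: "integrable M (indicator E :: 'a \<Rightarrow> complex)" if "E \<in> sets M" for E
    using that by (intro integrable_const_bound[of _ 1]) (auto simp: indicator_def)
  have m_add: "m (E \<union> F) = m E + m F" if "E \<in> sets M" "F \<in> sets M" "E \<inter> F = {}" for E F
  proof -
    have "(indicator (E \<union> F) :: 'a \<Rightarrow> complex) = (\<lambda>x. indicator E x + indicator F x)"
      using that(3) by (auto simp: indicator_def fun_eq_iff)
    then show ?thesis using add[OF int_ind int_ind] that by (simp add: m_def)
  qed
  have m_bound: "cmod (m E) \<le> C * measure M E" if "E \<in> sets M" for E
  proof -
    have "(\<lambda>x. cmod (indicator E x)) = indicat_real E" by (auto simp: indicator_def)
    then show ?thesis
      using bound[OF int_ind[OF that]] that sets.sets_into_space[OF that] by (simp add: m_def Int_absorb2)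
  qed
  obtain u where u: "integrable M u" "\<And>E. E \<in> sets M \<Longrightarrow> (LINT x:E|M. u x) = Re (m E)"
  proof (rule bounded_additive_set_function_has_density)
    show "Re (m (E \<union> F)) = Re (m E) + Re (m F)" if "E \<in> sets M" "F \<in> sets M" "E \<inter> F = {}" for E F
      using m_add[OF that] by simp
    show "\<bar>Re (m E)\<bar> \<le> C * measure M E" if "E \<in> sets M" for E
      using abs_Re_le_cmod m_bound[OF that] by (rule order_trans)
  qed blast
  obtain v where v: "integrable M v" "\<And>E. E \<in> sets M \<Longrightarrow> (LINT x:E|M. v x) = Im (m E)"
  proof (rule bounded_additive_set_function_has_density)
    show "Im (m (E \<union> F)) = Im (m E) + Im (m F)" if "E \<in> sets M" "F \<in> sets M" "E \<inter> F = {}" for E F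
      using m_add[OF that] by simp
    show "\<bar>Im (m E)\<bar> \<le> C * measure M E" if "E \<in> sets M" for E
      using abs_Im_le_cmod m_bound[OF that] by (rule order_trans)
  qed blast
  define h where "h x = Complex (u x) (v x)" for x
  have h_eq: "h = (\<lambda>x. complex_of_real (u x) + \<i> * complex_of_real (v x))"
    by (auto simp: h_def fun_eq_iff complex_eq_iff)
  have int_h: "integrable M h" unfolding h_eq using u v by auto
  have int_hE: "set_integrable M E h" if "E \<in> sets M" for E
    using that int_h by (simp add: set_integrable_def integrable_mult_indicator)
  have h_set: "(LINT x:E|M. h x) = m E" if "E \<in> sets M" for E
  proof (rule complex_eqI)
    show "Re (LINT x:E|M. h x) = Re (m E)"
      using int_hE[OF that] u(2)[OF that] integral_Re[of M "\<lambda>x. indicator E x *\<^sub>R h x"]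
      by (simp add: set_lebesgue_integral_def set_integrable_def h_def)
    show "Im (LINT x:E|M. h x) = Im (m E)"
      using int_hE[OF that] v(2)[OF that] integral_Im[of M "\<lambda>x. indicator E x *\<^sub>R h x"]
      by (simp add: set_lebesgue_integral_def set_integrable_def h_def)
  qed
  have h_le: "AE x in M. cmod (h x) \<le> C"
    using \<open>0 \<le> C\<close> int_hE m_bound by (intro AE_norm_le_if_set_integrals_le) (auto simp: h_set)
  have int_fh: "integrable M (\<lambda>x. f x * h x)" if f: "integrable M f" for f
  proof (rule Bochner_Integration.integrable_bound)
    show "integrable M (\<lambda>x. C * cmod (f x))" using f by simp
    show "AE x in M. cmod (f x * h x) \<le> norm (C * cmod (f x))"
      using h_le
      by eventually_elim (use \<open>0 \<le> C\<close> in \<open>simp add: norm_mult mult.commute[of "cmod (f _)"] mult_right_mono\<close>)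
  qed (use f int_h in auto)
  have "\<Phi> f = (LINT x|M. f x * h x)" if "integrable M f" for f
    using that
  proof (induction rule: integrable_induct)
    case (base A c)
    have "\<Phi> (\<lambda>x. indicator A x *\<^sub>R c) = \<Phi> (\<lambda>x. c * indicator A x)"
      by (intro arg_cong[of _ _ \<Phi>]) (auto simp: indicator_def)
    also have "\<dots> = c * (LINT x:A|M. h x)"
      using base by (simp add: scale int_ind h_set m_def)
    also have "\<dots> = (LINT x|M. c * (indicator A x *\<^sub>R h x))"
      unfolding set_lebesgue_integral_def by (rule integral_mult_right_zero[symmetric])
    also have "\<dots> = (LINT x|M. indicator A x *\<^sub>R c * h x)"
      by (intro Bochner_Integration.integral_cong) (auto simp: indicator_def)
    finally show ?case .
  next
    case (add f g)
    have "(LINT x|M. (f x + g x) * h x) = (LINT x|M. f x * h x) + (LINT x|M. g x * h x)"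
      unfolding distrib_right using add.hyps int_fh by (intro Bochner_Integration.integral_add) auto
    then show ?case using assms(2)[OF add.hyps] add.IH by (simp only:)
  next
    case (lim f s)
    have s_int: "\<And>i. integrable M (s i)" and f_int: "integrable M f"
      and s_rep: "\<And>i. \<Phi> (s i) = (LINT x|M. s i x * h x)"
      and s_lim: "\<And>x. x \<in> space M \<Longrightarrow> (\<lambda>i. s i x) \<longlonglongrightarrow> f x"
      and s_le: "\<And>i x. x \<in> space M \<Longrightarrow> cmod (s i x) \<le> 2 * cmod (f x)"
      using lim.hyps lim.IH by simp_all
    have diff: "\<Phi> (\<lambda>x. s i x + (-1) * f x) = \<Phi> (s i) - \<Phi> f" for i
      using assms(2)[of "s i" "\<lambda>x. (-1) * f x"] scale[of f "-1"] s_int f_int by simp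
    have "(\<lambda>i. LINT x|M. cmod (s i x + (-1) * f x)) \<longlonglongrightarrow> (LINT x|M. 0)"
    proof (rule integral_dominated_convergence)
      show "integrable M (\<lambda>x. 3 * cmod (f x))" using f_int by simp
      show "AE x in M. (\<lambda>i. cmod (s i x + (-1) * f x)) \<longlonglongrightarrow> 0"
        using s_lim by (intro AE_I2 tendsto_norm_zero) (simp add: LIM_zero)
      show "AE x in M. norm (cmod (s i x + (-1) * f x)) \<le> 3 * cmod (f x)" for i
      proof (rule AE_I2)
        fix x assume "x \<in> space M"
        then show "norm (cmod (s i x + (-1) * f x)) \<le> 3 * cmod (f x)"
          using s_le[of x i] norm_triangle_ineq4[of "s i x" "f x"] by simp
      qed
    qed (use s_int f_int in auto)
    then have C_lim: "(\<lambda>i. C * (LINT x|M. cmod (s i x + (-1) * f x))) \<longlonglongrightarrow> 0"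
      by (intro tendsto_mult_right_zero) simp
    have "cmod (\<Phi> (s i) - \<Phi> f) \<le> C * (LINT x|M. cmod (s i x + (-1) * f x))" for i
      using s_int f_int
      by (intro bound[of "\<lambda>x. s i x + (-1) * f x", unfolded diff]) auto
    then have "(\<lambda>i. \<Phi> (s i) - \<Phi> f) \<longlonglongrightarrow> 0"
      by (intro Lim_null_comparison[OF _ C_lim] always_eventually allI)
    then have \<Phi>_lim: "(\<lambda>i. \<Phi> (s i)) \<longlonglongrightarrow> \<Phi> f" by (simp add: LIM_zero_iff)
    have "(\<lambda>i. LINT x|M. s i x * h x) \<longlonglongrightarrow> (LINT x|M. f x * h x)"
    proof (rule integral_dominated_convergence)
      show "integrable M (\<lambda>x. 2 * cmod (f x * h x))" using int_fh f_int by simp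
      show "AE x in M. (\<lambda>i. s i x * h x) \<longlonglongrightarrow> f x * h x"
        using s_lim by (intro AE_I2 tendsto_mult) auto
      show "AE x in M. cmod (s i x * h x) \<le> 2 * cmod (f x * h x)" for i
      proof (rule AE_I2)
        fix x assume "x \<in> space M"
        then show "cmod (s i x * h x) \<le> 2 * cmod (f x * h x)"
          using mult_right_mono[OF s_le[of x i] norm_ge_zero[of "h x"]] by (simp add: norm_mult mult.assoc)
      qed
    qed (use s_int f_int int_h in auto)
    then show ?case by (rule LIMSEQ_unique[OF \<Phi>_lim[unfolded s_rep]])
  qed
  then show ?thesis by (rule that[OF borel_measurable_integrable[OF int_h] h_le])
qed

text \<open>
  Multiplication by a positive integrable weight \<open>w\<close> is an isometry of \<open>L\<^sup>1\<close> of the finite measure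
  \<open>w dM\<close> onto \<open>L\<^sup>1\<close> of \<open>M\<close>. It transports the representation from the finite case, with the same
  function \<open>h\<close>.
\<close>

theorem (in sigma_finite_measure) L1_dual_representation:
  fixes \<Phi> :: "('a \<Rightarrow> complex) \<Rightarrow> complex"
  assumes "0 \<le> C"
    and add: "\<And>f g. integrable M f \<Longrightarrow> integrable M g \<Longrightarrow> \<Phi> (\<lambda>x. f x + g x) = \<Phi> f + \<Phi> g"
    and scale: "\<And>c f. integrable M f \<Longrightarrow> \<Phi> (\<lambda>x. c * f x) = c * \<Phi> f"
    and bound: "\<And>f. integrable M f \<Longrightarrow> cmod (\<Phi> f) \<le> C * (LINT x|M. cmod (f x))"
  obtains h where "h \<in> borel_measurable M" and "AE x in M. cmod (h x) \<le> C"
    and "\<And>f. integrable M f \<Longrightarrow> \<Phi> f = (LINT x|M. f x * h x)"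
proof -
  obtain w0 where w0: "w0 \<in> borel_measurable M" "integral\<^sup>N M w0 \<noteq> \<infinity>"
      "\<And>x. x \<in> space M \<Longrightarrow> 0 < w0 x \<and> w0 x < \<infinity>"
    using Ex_finite_integrable_function by blast
  define w where "w x = enn2real (w0 x)" for x
  have w_meas [measurable]: "w \<in> borel_measurable M" using w0(1) unfolding w_def by measurable
  have w_nonneg: "0 \<le> w x" for x by (simp add: w_def)
  have w_pos: "0 < w x" if "x \<in> space M" for x
    using w0(3)[OF that] by (simp add: w_def enn2real_positive_iff)
  define M' where "M' = density M (\<lambda>x. ennreal (w x))"
  have sets_M' [simp, measurable_cong]: "sets M' = sets M" and space_M' [simp]: "space M' = space M"
    by (simp_all add: M'_def)
  have "(\<integral>\<^sup>+x. ennreal (w x) \<partial>M) = integral\<^sup>N M w0"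
    using w0(3) by (intro nn_integral_cong) (simp add: w_def)
  then interpret M': finite_measure M'
    using w0(2) by (intro finite_measureI) (simp add: M'_def emeasure_density cong: nn_integral_cong)
  have int_M': "integrable M' g \<longleftrightarrow> integrable M (\<lambda>x. w x *\<^sub>R g x)"
    if "g \<in> borel_measurable M" for g :: "'a \<Rightarrow> 'c::{banach, second_countable_topology}"
    unfolding M'_def using that w_nonneg by (intro integrable_density) auto
  have integral_M': "integral\<^sup>L M' g = (LINT x|M. w x *\<^sub>R g x)"
    if "g \<in> borel_measurable M" for g :: "'a \<Rightarrow> 'c::{banach, second_countable_topology}"
    unfolding M'_def using that w_nonneg by (intro integral_density) auto
  have weighted: "integrable M (\<lambda>x. w x *\<^sub>R g x)" if "integrable M' g" for g :: "'a \<Rightarrow> complex"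
    using that int_M'[of g] borel_measurable_integrable[OF that] by simp
  define \<Phi>' where "\<Phi>' g = \<Phi> (\<lambda>x. w x *\<^sub>R g x)" for g
  obtain h where h: "h \<in> borel_measurable M'" "AE x in M'. cmod (h x) \<le> C"
    and rep: "\<And>g. integrable M' g \<Longrightarrow> \<Phi>' g = (LINT x|M'. g x * h x)"
  proof (rule M'.finite_L1_dual_representation[of C \<Phi>'])
    show "\<Phi>' (\<lambda>x. f x + g x) = \<Phi>' f + \<Phi>' g" if "integrable M' f" "integrable M' g" for f g
      using add[OF weighted weighted] that by (simp add: \<Phi>'_def scaleR_add_right)
    show "\<Phi>' (\<lambda>x. c * f x) = c * \<Phi>' f" if "integrable M' f" for c f
      using scale[OF weighted[OF that], of c] by (simp add: \<Phi>'_def)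
    show "cmod (\<Phi>' f) \<le> C * (LINT x|M'. cmod (f x))" if "integrable M' f" for f
      using bound[OF weighted[OF that]] borel_measurable_integrable[OF that] w_nonneg
      by (simp add: \<Phi>'_def integral_M')
  qed (use \<open>0 \<le> C\<close> in auto)
  \<comment> \<open>The quotient by \<open>w\<close> below recovers \<open>f\<close> only on the space of \<open>M\<close>, so \<open>\<Phi>\<close> must not see the rest.\<close>
  have cong: "\<Phi> f = \<Phi> g" if "integrable M f" "integrable M g" "\<And>x. x \<in> space M \<Longrightarrow> f x = g x" for f g
  proof -
    have "\<Phi> (\<lambda>x. f x + (-1) * g x) = \<Phi> f - \<Phi> g"
      using add[of f "\<lambda>x. (-1) * g x"] scale[of g "-1"] that by simp
    moreover have "(LINT x|M. cmod (f x + (-1) * g x)) = (LINT x|M. 0)"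
      using that(3) by (intro Bochner_Integration.integral_cong) auto
    ultimately show ?thesis using bound[of "\<lambda>x. f x + (-1) * g x"] that by simp
  qed
  have "\<Phi> f = (LINT x|M. f x * h x)" if f: "integrable M f" for f
  proof -
    define g where "g x = f x / complex_of_real (w x)" for x
    have wg: "w x *\<^sub>R g x = f x" if "x \<in> space M" for x
      using w_pos[OF that] by (simp add: g_def scaleR_conv_of_real)
    have g_meas: "g \<in> borel_measurable M" using f unfolding g_def by measurable
    have int_wg: "integrable M (\<lambda>x. w x *\<^sub>R g x)"
      using f wg by (simp cong: Bochner_Integration.integrable_cong)
    have "\<Phi> f = \<Phi>' g"
      unfolding \<Phi>'_def by (rule cong) (use f int_wg wg in auto)
    also have "\<dots> = (LINT x|M'. g x * h x)" using rep int_M' g_meas int_wg by blast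
    also have "\<dots> = (LINT x|M. w x *\<^sub>R (g x * h x))"
      using g_meas h(1) by (intro integral_M') auto
    also have "\<dots> = (LINT x|M. f x * h x)"
      by (intro Bochner_Integration.integral_cong refl) (simp flip: wg)
    finally show ?thesis .
  qed
  moreover have "AE x in M. cmod (h x) \<le> C"
    using h(2) w_pos unfolding M'_def by (subst (asm) AE_density) (auto elim!: AE_mp intro!: AE_I2)
  ultimately show ?thesis using that[of h] h(1) by simp
qed

section \<open>Norms of functions on the line\<close>

interpretation lebesgue: sigma_finite_measure "lebesgue :: 'a::euclidean_space measure"
proof
  have "(\<Union>n::nat. cball 0 (real n)) = (UNIV :: 'a set)"
    using real_arch_simple by (auto simp: set_eq_iff)
  then show "\<exists>A::'a set set. countable A \<and> A \<subseteq> sets lebesgue \<and> \<Union>A = space lebesgue \<and>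
      (\<forall>a\<in>A. emeasure lebesgue a \<noteq> \<infinity>)"
    using fmeasurableD2[OF lmeasurable_cball]
    by (intro exI[of _ "range (\<lambda>n::nat. cball 0 (real n))"]) auto
qed

lemma Lnorm_1_eq:
  assumes "f \<in> L1"
  shows "Lnorm 1 f = ennreal (LINT x|lebesgue. cmod (f x))"
proof -
  have "(\<integral>\<^sup>+x. ennreal (cmod (f x)) \<partial>lebesgue) = ennreal (LINT x|lebesgue. cmod (f x))"
    using assms by (intro nn_integral_eq_integral) (auto simp: L1_def)
  then show ?thesis by (simp add: Lnorm_def ennpow_def)
qed

lemma AE_cmod_le_Lnorm_infinity:
  assumes "Lnorm \<infinity> f \<le> ennreal C" "0 \<le> C"
  shows "AE x in lebesgue. cmod (f x) \<le> C"
proof -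
  have "AE x in lebesgue. ennreal (cmod (f x)) \<le> Lnorm \<infinity> f"
    using esssup_AE by (simp add: Lnorm_def)
  then show ?thesis
  proof eventually_elim
    case (elim x)
    then show ?case using order_trans[OF elim assms(1)] \<open>0 \<le> C\<close> by simp
  qed
qed

lemma Lnorm_infinity_le:
  assumes "f \<in> borel_measurable lebesgue" "AE x in lebesgue. cmod (f x) \<le> C"
  shows "Lnorm \<infinity> f \<le> ennreal C"
proof -
  have "AE x in lebesgue. ennreal (cmod (f x)) \<le> ennreal C"
    using assms(2) by eventually_elim (rule ennreal_leI)
  then show ?thesis using assms(1) by (simp add: Lnorm_def esssup_I)
qed

lemma AE_cmod_eq_0_if_integral_eq_0:
  assumes "f \<in> L1" "(LINT x|lebesgue. cmod (f x)) = 0"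
  shows "AE x in lebesgue. f x = 0"
  using assms integral_nonneg_eq_0_iff_AE[of lebesgue "\<lambda>x. cmod (f x)"] by (auto simp: L1_def)

text \<open>
  The interpolation \<open>\<parallel>f\<parallel>\<^sub>q \<le> \<parallel>f\<parallel>\<^sub>\<infinity>\<^sup>1\<^sup>-\<^sup>1\<^sup>/\<^sup>q \<parallel>f\<parallel>\<^sub>1\<^sup>1\<^sup>/\<^sup>q\<close>, from \<open>|f|\<^sup>q \<le> S\<^sup>q\<^sup>-\<^sup>1 |f|\<close>. Since \<open>0 powr 0 = 0\<close>, the
  right-hand side vanishes for every \<open>q\<close> when \<open>f\<close> is null (and for \<open>q = 1\<close> when \<open>S = 0\<close>); the
  inequality survives because the left-hand side vanishes too.
\<close>

lemma Lnorm_interpolation: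
  assumes f: "f \<in> L1" and "AE x in lebesgue. cmod (f x) \<le> S" and "0 \<le> S" and "1 \<le> q"
  shows "Lnorm q f \<le> ennreal (S powr (1 - enn2real (1 / q)) *
    (LINT x|lebesgue. cmod (f x)) powr enn2real (1 / q))"
proof -
  define a where "a = (LINT x|lebesgue. cmod (f x))"
  have a_nonneg: "0 \<le> a" by (simp add: a_def)
  have f_meas [measurable]: "f \<in> borel_measurable lebesgue" using f by (auto simp: L1_def)
  show ?thesis unfolding a_def[symmetric]
  proof (cases "a = 0")
    case True
    then have f0: "AE x in lebesgue. f x = 0"
      using AE_cmod_eq_0_if_integral_eq_0 f by (simp add: a_def)
    have "Lnorm q f = 0"
    proof (cases "q = \<infinity>")
      case True
      have "Lnorm \<infinity> f \<le> ennreal 0" using f0 by (intro Lnorm_infinity_le) auto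
      then show ?thesis using True by simp
    next
      case False
      have "(\<integral>\<^sup>+x. ennreal (cmod (f x) powr enn2real q) \<partial>lebesgue) = (\<integral>\<^sup>+(x::real). 0 \<partial>lebesgue)"
        using f0 by (intro nn_integral_cong_AE) (auto elim: eventually_mono)
      then show ?thesis using False by (simp add: Lnorm_def ennpow_def)
    qed
    then show "Lnorm q f \<le> ennreal (S powr (1 - enn2real (1 / q)) * a powr enn2real (1 / q))" by simp
  next
    case a: False
    show "Lnorm q f \<le> ennreal (S powr (1 - enn2real (1 / q)) * a powr enn2real (1 / q))"
    proof (cases "q = \<infinity>")
      case True
      then show ?thesis using Lnorm_infinity_le[OF f_meas assms(2)] a \<open>0 \<le> S\<close> by simp
    next
      case False
      define p where "p = enn2real q"
      have q_eq: "q = ennreal p" using False by (simp add: p_def less_top)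
      have p: "1 \<le> p" using \<open>1 \<le> q\<close> unfolding q_eq by (simp add: ennreal_le_iff2 flip: ennreal_1)
      have inv: "enn2real (1 / q) = 1 / p"
        using p by (simp add: q_eq divide_ennreal ennreal_1[symmetric] del: ennreal_1)
      have pw: "t powr p \<le> S powr (p - 1) * t" if "0 \<le> t" "t \<le> S" for t :: real
      proof (cases "t = 0")
        case False
        then have "t powr p = t powr (p - 1) * t" using that by (simp add: powr_diff)
        then show ?thesis using that p by (auto intro!: mult_right_mono powr_mono2)
      qed simp
      have "(\<integral>\<^sup>+x. ennreal (cmod (f x) powr p) \<partial>lebesgue)
          \<le> (\<integral>\<^sup>+x. ennreal (S powr (p - 1) * cmod (f x)) \<partial>lebesgue)"
      proof (rule nn_integral_mono_AE)
        show "AE x in lebesgue. ennreal (cmod (f x) powr p) \<le> ennreal (S powr (p - 1) * cmod (f x))"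
          using assms(2) by eventually_elim (intro ennreal_leI pw norm_ge_zero)
      qed
      also have "\<dots> = ennreal (LINT x|lebesgue. S powr (p - 1) * cmod (f x))"
        using f by (intro nn_integral_eq_integral) (auto simp: L1_def)
      also have "\<dots> = ennreal (S powr (p - 1) * a)" by (simp add: a_def)
      finally have I: "(\<integral>\<^sup>+x. ennreal (cmod (f x) powr p) \<partial>lebesgue) \<le> ennreal (S powr (p - 1) * a)" .
      then obtain r where r: "0 \<le> r" "(\<integral>\<^sup>+x. ennreal (cmod (f x) powr p) \<partial>lebesgue) = ennreal r"
        by (metis ennreal_cases ennreal_neq_top top.extremum_unique)
      then have "r \<le> S powr (p - 1) * a" using I a_nonneg by simp
      then have "r powr (1 / p) \<le> (S powr (p - 1) * a) powr (1 / p)"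
        using r p by (intro powr_mono2) auto
      also have "\<dots> = S powr (1 - 1 / p) * a powr (1 / p)"
        using p \<open>0 \<le> S\<close> a_nonneg by (simp add: powr_mult powr_powr diff_divide_distrib)
      finally show ?thesis
        using False r by (simp add: Lnorm_def ennpow_def inv flip: p_def)
    qed
  qed
qed

lemma borel_measurable_cnj:
  "u \<in> borel_measurable M \<Longrightarrow> (\<lambda>x. cnj (u x)) \<in> borel_measurable M"
  by (rule borel_measurable_continuous_on[OF continuous_on_cnj[OF continuous_on_id]])

lemma linear_L1_Linf_measurable:
  assumes "linear_L1_Linf A" "f \<in> L1"
  shows "A f \<in> borel_measurable lebesgue"
  using assms by (auto simp: linear_L1_Linf_def Linf_def)

section \<open>The adjoint of a contraction\<close>

lemma integrable_bounded_mult: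
  fixes u v :: "'a \<Rightarrow> complex"
  assumes "integrable M v" "u \<in> borel_measurable M" "AE x in M. cmod (u x) \<le> S"
  shows "integrable M (\<lambda>x. u x * v x)"
proof (rule Bochner_Integration.integrable_bound)
  show "integrable M (\<lambda>x. S * cmod (v x))" using assms by simp
  show "AE x in M. cmod (u x * v x) \<le> norm (S * cmod (v x))"
    using assms(3)
  proof eventually_elim
    case (elim x)
    then have "cmod (u x) \<le> \<bar>S\<bar>" by simp
    then show ?case by (simp add: norm_mult abs_mult mult_right_mono)
  qed
qed (use assms in auto)

lemma cmod_integral_mult_le:
  fixes u v :: "'a \<Rightarrow> complex"
  assumes v: "integrable M v" and u: "u \<in> borel_measurable M" "AE x in M. cmod (u x) \<le> S"
  shows "cmod (LINT x|M. u x * v x) \<le> S * (LINT x|M. cmod (v x))"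
proof -
  have "cmod (LINT x|M. u x * v x) \<le> (LINT x|M. cmod (u x * v x))"
    by (rule integral_norm_bound)
  also have "\<dots> \<le> (LINT x|M. S * cmod (v x))"
  proof (rule integral_mono_AE)
    show "AE x in M. cmod (u x * v x) \<le> S * cmod (v x)"
      using u(2) by eventually_elim (simp add: norm_mult mult_right_mono)
  qed (use integrable_bounded_mult[OF v u] v in auto)
  finally show ?thesis by simp
qed

lemma contraction_AE_bound:
  assumes "\<forall>f\<in>L1. Lnorm \<infinity> (A f) \<le> Lnorm 1 f" and "f \<in> L1"
  shows "AE x in lebesgue. cmod (A f x) \<le> (LINT x|lebesgue. cmod (f x))"
  using assms by (intro AE_cmod_le_Lnorm_infinity) (auto simp flip: Lnorm_1_eq)

text \<open>
  The operator \<open>adjoint_op A\<close> is a Hilbert choice, so it has the adjoint property only once some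
  adjoint is known to exist. For fixed \<open>g\<close> the functional \<open>f \<mapsto> \<integral> A f \<cdot> cnj g\<close> on \<open>L\<^sup>1\<close> has norm at
  most \<open>\<parallel>g\<parallel>\<^sub>1\<close>, and the conjugate of the function that represents it serves as the value at \<open>g\<close>.
\<close>

lemma adjoint_op_is_adjoint:
  assumes lin: "linear_L1_Linf A" and contr: "\<forall>f\<in>L1. Lnorm \<infinity> (A f) \<le> Lnorm 1 f"
  shows "is_adjoint A (adjoint_op A)"
proof -
  have "\<exists>h. h \<in> Linf \<and> (\<forall>f\<in>L1. (LINT x|lebesgue. A f x * cnj (g x)) = (LINT x|lebesgue. f x * cnj (h x)))"
    if g: "g \<in> L1" for g
  proof -
    define \<Phi> where "\<Phi> f = (LINT x|lebesgue. A f x * cnj (g x))" for f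
    define G where "G = (LINT x|lebesgue. cmod (g x))"
    have cg: "integrable lebesgue (\<lambda>x. cnj (g x))" using g by (simp add: L1_def)
    have meas: "A f \<in> borel_measurable lebesgue" if "integrable lebesgue f" for f
      using linear_L1_Linf_measurable[OF lin] that by (simp add: L1_def)
    have bd: "AE x in lebesgue. cmod (A f x) \<le> (LINT x|lebesgue. cmod (f x))"
      if "integrable lebesgue f" for f
      using contraction_AE_bound[OF contr] that by (simp add: L1_def)
    have int: "integrable lebesgue (\<lambda>x. A f x * cnj (g x))" if "integrable lebesgue f" for f
      using integrable_bounded_mult[OF cg meas[OF that] bd[OF that]] .
    obtain h where h: "h \<in> borel_measurable lebesgue" "AE x in lebesgue. cmod (h x) \<le> G"
      and rep: "\<And>f. integrable lebesgue f \<Longrightarrow> \<Phi> f = (LINT x|lebesgue. f x * h x)"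
    proof (rule lebesgue.L1_dual_representation[of G \<Phi>])
      fix u v :: "real \<Rightarrow> complex" assume uv: "integrable lebesgue u" "integrable lebesgue v"
      have ae: "AE x in lebesgue. A (\<lambda>t. u t + v t) x = A u x + A v x"
        using lin uv by (auto simp: linear_L1_Linf_def L1_def)
      have "\<Phi> (\<lambda>x. u x + v x) = (LINT x|lebesgue. A u x * cnj (g x) + A v x * cnj (g x))"
        unfolding \<Phi>_def
      proof (rule integral_cong_AE)
        show "AE x in lebesgue. A (\<lambda>x. u x + v x) x * cnj (g x) = A u x * cnj (g x) + A v x * cnj (g x)"
          using ae by eventually_elim (simp add: distrib_right)
      qed (use int uv in \<open>auto intro!: borel_measurable_integrable\<close>)
      then show "\<Phi> (\<lambda>x. u x + v x) = \<Phi> u + \<Phi> v"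
        using int uv by (simp add: \<Phi>_def)
    next
      fix c and u :: "real \<Rightarrow> complex" assume u: "integrable lebesgue u"
      have ae: "AE x in lebesgue. A (\<lambda>t. c * u t) x = c * A u x"
        using lin u by (auto simp: linear_L1_Linf_def L1_def)
      have "\<Phi> (\<lambda>x. c * u x) = (LINT x|lebesgue. c * (A u x * cnj (g x)))"
        unfolding \<Phi>_def
      proof (rule integral_cong_AE)
        show "AE x in lebesgue. A (\<lambda>x. c * u x) x * cnj (g x) = c * (A u x * cnj (g x))"
          using ae by eventually_elim simp
      qed (use int u in \<open>auto intro!: borel_measurable_integrable\<close>)
      then show "\<Phi> (\<lambda>x. c * u x) = c * \<Phi> u" by (simp add: \<Phi>_def)
    next
      fix u :: "real \<Rightarrow> complex" assume u: "integrable lebesgue u"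
      show "cmod (\<Phi> u) \<le> G * (LINT x|lebesgue. cmod (u x))"
        using cmod_integral_mult_le[OF cg meas[OF u] bd[OF u]] by (simp add: \<Phi>_def G_def mult.commute)
    qed (auto simp: G_def)
    have "Lnorm \<infinity> (\<lambda>x. cnj (h x)) \<le> ennreal G"
      using h by (intro Lnorm_infinity_le borel_measurable_cnj) auto
    then have "(\<lambda>x. cnj (h x)) \<in> Linf"
      using borel_measurable_cnj[OF h(1)] by (auto simp: Linf_def intro: le_less_trans)
    then show ?thesis using rep by (intro exI[of _ "\<lambda>x. cnj (h x)"]) (auto simp: \<Phi>_def L1_def)
  qed
  then have "\<exists>B. \<forall>g\<in>L1. B g \<in> Linf \<and>
      (\<forall>f\<in>L1. (LINT x|lebesgue. A f x * cnj (g x)) = (LINT x|lebesgue. f x * cnj (B g x)))"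
    by (intro bchoice) blast
  then have "\<exists>B. is_adjoint A B" unfolding is_adjoint_def by blast
  then show ?thesis unfolding adjoint_op_def by (rule someI_ex)
qed

text \<open>
  Testing the adjoint identity on indicators: the integral of \<open>cnj (B g)\<close> over \<open>E\<close> equals
  \<open>\<integral> A (indicator E) \<cdot> cnj g\<close>, which is at most the measure of \<open>E\<close> times \<open>\<parallel>g\<parallel>\<^sub>1\<close>. So all averages
  of \<open>B g\<close> are bounded by \<open>\<parallel>g\<parallel>\<^sub>1\<close>.
\<close>

lemma adjoint_contraction:
  assumes lin: "linear_L1_Linf A" and contr: "\<forall>f\<in>L1. Lnorm \<infinity> (A f) \<le> Lnorm 1 f"
    and adj: "is_adjoint A B" and g: "g \<in> L1"
  shows "Lnorm \<infinity> (B g) \<le> Lnorm 1 g"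
proof -
  define G where "G = (LINT x|lebesgue. cmod (g x))"
  have cg: "integrable lebesgue (\<lambda>x. cnj (g x))" using g by (simp add: L1_def)
  have Bg: "B g \<in> borel_measurable lebesgue" "Lnorm \<infinity> (B g) < \<infinity>"
    using adj g by (auto simp: is_adjoint_def Linf_def)
  have cBg: "(\<lambda>x. cnj (B g x)) \<in> borel_measurable lebesgue"
    using Bg(1) by (rule borel_measurable_cnj)
  obtain S where S: "0 \<le> S" "Lnorm \<infinity> (B g) = ennreal S"
    using Bg(2) by (cases "Lnorm \<infinity> (B g)") auto
  have Bg_le: "AE x in lebesgue. cmod (B g x) \<le> S"
    by (rule AE_cmod_le_Lnorm_infinity) (use S in auto)
  have ind: "integrable lebesgue (indicator E :: real \<Rightarrow> complex)"
    if "E \<in> sets lebesgue" "emeasure lebesgue E < \<infinity>" for E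
  proof -
    have "integrable lebesgue (\<lambda>x. complex_of_real (indicat_real E x))"
      using that by (intro integrable_of_real) (simp add: integrable_indicator_iff)
    then show ?thesis by (simp add: of_real_indicator)
  qed
  have "AE x in lebesgue. cmod (cnj (B g x)) \<le> G"
  proof (rule lebesgue.AE_norm_le_if_set_integrals_le)
    fix E :: "real set" assume E: "E \<in> sets lebesgue" "emeasure lebesgue E < \<infinity>"
    have indE: "(indicator E :: real \<Rightarrow> complex) \<in> L1" using ind[OF E] by (simp add: L1_def)
    have conv: "indicator E x *\<^sub>R cnj (B g x) = cnj (B g x) * indicator E x" for x
      by (simp add: indicator_def)
    show "set_integrable lebesgue E (\<lambda>x. cnj (B g x))"
      unfolding set_integrable_def conv using cBg Bg_le
      by (intro integrable_bounded_mult[OF ind[OF E], of _ S]) auto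
    have norm_ind: "(LINT x|lebesgue. cmod (indicator E x)) = measure lebesgue E"
    proof -
      have "(\<lambda>x. cmod (indicator E x)) = indicat_real E" by (auto simp: indicator_def)
      then show ?thesis using E by simp
    qed
    have "(LINT x:E|lebesgue. cnj (B g x)) = (LINT x|lebesgue. indicator E x * cnj (B g x))"
      unfolding set_lebesgue_integral_def conv by (simp add: mult.commute)
    also have "\<dots> = (LINT x|lebesgue. A (indicator E) x * cnj (g x))"
      using adj g indE by (simp add: is_adjoint_def)
    finally show "cmod (LINT x:E|lebesgue. cnj (B g x)) \<le> G * measure lebesgue E"
      using cmod_integral_mult_le[OF cg linear_L1_Linf_measurable[OF lin indE] contraction_AE_bound[OF contr indE]]
      by (simp add: norm_ind G_def mult.commute)
  qed (simp add: G_def)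
  then have "Lnorm \<infinity> (B g) \<le> ennreal G" using Bg(1) by (intro Lnorm_infinity_le) auto
  then show ?thesis using g by (simp add: Lnorm_1_eq G_def)
qed

section \<open>The uncertainty principle\<close>

theorem theorem4p6:
  fixes A :: "(real \<Rightarrow> complex) \<Rightarrow> (real \<Rightarrow> complex)"
    and f :: "real \<Rightarrow> complex"
    and k :: real
    and q :: ennreal
  assumes "k > 0"
    and "hadamard_op k A"
    and "doubly_L1 A f"
    and "1 \<le> q"
  shows "Lnorm 1 f * Lnorm 1 (A f)
           \<ge> ennreal (k powr (1 - enn2real (1 / q))) * Lnorm q f * Lnorm q (A f)"
proof -
  have lin: "linear_L1_Linf A" and contr: "\<forall>f\<in>L1. Lnorm \<infinity> (A f) \<le> Lnorm 1 f"
    and lower: "ennreal k * Lnorm \<infinity> f \<le> Lnorm \<infinity> (adjoint_op A (A f))"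
    and f: "f \<in> L1" and Af: "A f \<in> L1"
    using assms(2,3) by (auto simp: hadamard_op_def doubly_L1_def)
  define a where "a = (LINT x|lebesgue. cmod (f x))"
  define b where "b = (LINT x|lebesgue. cmod (A f x))"
  have ab: "0 \<le> a" "0 \<le> b" by (simp_all add: a_def b_def)
  define t where "t = enn2real (1 / q)"
  have "ennreal k * Lnorm \<infinity> f \<le> ennreal b"
    using lower adjoint_contraction[OF lin contr adjoint_op_is_adjoint[OF lin contr] Af] Lnorm_1_eq[OF Af]
    by (simp add: b_def)
  then have "ennreal (1 / k) * (ennreal k * Lnorm \<infinity> f) \<le> ennreal (1 / k) * ennreal b"
    by (rule mult_left_mono) simp
  then have "Lnorm \<infinity> f \<le> ennreal (b / k)"
    using \<open>k > 0\<close> ab by (simp flip: mult.assoc ennreal_mult)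
  then have "AE x in lebesgue. cmod (f x) \<le> b / k"
    by (rule AE_cmod_le_Lnorm_infinity) (use \<open>k > 0\<close> ab in simp)
  then have qf: "Lnorm q f \<le> ennreal ((b / k) powr (1 - t) * a powr t)"
    unfolding a_def t_def using f assms(1,4) ab by (intro Lnorm_interpolation) auto
  have qAf: "Lnorm q (A f) \<le> ennreal (a powr (1 - t) * b powr t)"
    unfolding b_def t_def using ab contraction_AE_bound[OF contr f]
    by (intro Lnorm_interpolation Af assms(4)) (simp_all add: a_def)
  have sum: "x powr (1 - t) * x powr t = x" if "0 \<le> x" for x :: real
    using that by (simp flip: powr_add)
  have "ennreal (k powr (1 - t)) * Lnorm q f * Lnorm q (A f)
      \<le> ennreal (k powr (1 - t)) * ennreal ((b / k) powr (1 - t) * a powr t)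
          * ennreal (a powr (1 - t) * b powr t)"
    by (intro mult_mono qf qAf) auto
  also have "\<dots> = ennreal (k powr (1 - t) * ((b / k) powr (1 - t) * a powr t)
          * (a powr (1 - t) * b powr t))"
    by (simp flip: ennreal_mult)
  also have "k powr (1 - t) * ((b / k) powr (1 - t) * a powr t) * (a powr (1 - t) * b powr t)
      = (k powr (1 - t) * (b / k) powr (1 - t)) * b powr t * (a powr (1 - t) * a powr t)"
    by (simp add: ac_simps)
  also have "k powr (1 - t) * (b / k) powr (1 - t) = b powr (1 - t)"
    using \<open>k > 0\<close> ab by (simp flip: powr_mult)
  also have "b powr (1 - t) * b powr t * (a powr (1 - t) * a powr t) = b * a"
    using ab by (simp add: sum)
  finally show ?thesis
    using ab f Af by (simp add: Lnorm_1_eq t_def ennreal_mult mult.commute flip: a_def b_def)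
qed

end
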